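(* Let $p_\theta$, $\theta\in\Theta\subseteq\mathbb R$, be the probability mass function of a real observation $S$, having a continuous derivative with respect to $\theta$. For each $s\in\mathcal S_0$, assume that the function $$\gamma_s(\theta)=\left(\frac{\partial p_\theta(s)}{\partial\theta}\right)\Big/\left(-\frac{\partial F_\theta(s)}{\partial\theta}\right)=\left(\frac{\partial p_\theta(s)}{\partial\theta}\right)\Big/h_s(\theta)$$ is decreasing on $\Theta$ and satisfies $$\lim_{\theta\to\inf\Theta}\gamma_s(\theta)=+\infty,\qquad\lim_{\theta\to\sup\Theta}\gamma_s(\theta)=-1.$$ Then, for each $s\in\mathcal S_0$, there exists $\theta^*\in\Theta$ (depending on $s$) such that $H_s^G(\theta)<H_s^A(\theta)$ for $\theta<\theta^*$ and $H_s^G(\theta)>H_s^A(\theta)$ for $\theta>\theta^*$ ($\theta\in\Theta$).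
   Context: $S$ is discrete with distribution function $F_\theta(s)=\Pr_\theta\{S\le s\}$, and $\Theta$ is an open interval. The right fiducial distribution function is $H_s(\theta)=1-F_\theta(s)=\Pr_\theta\{S>s\}$ and the left fiducial distribution function is $H_s^\ell(\theta)=1-\Pr_\theta\{S<s\}=\Pr_\theta\{S\ge s\}$. $\mathcal S_0$ is the set of those $s$ for which both can be defined, i.e. both $H_s$ and $H_s^\ell$ are distribution functions in $\theta$ on $\Theta$ (increasing and differentiable, with limits $0$ and $1$ as $\theta\to\inf\Theta$ and $\theta\to\sup\Theta$). Their densities are $h_s(\theta)=\frac{\partial}{\partial\theta}H_s(\theta)=-\frac{\partial}{\partial\theta}F_\theta(s)$, which is taken to be positive on $\Theta$ so that $\gamma_s$ is well defined, and $h_s^\ell(\theta)=\frac{\partial}{\partial\theta}H_s^\ell(\theta)$. The arithmetic mean is $H_s^A(\theta)=(H_s(\theta)+H_s^\ell(\theta))/2$. The geometric mean fiducial density is $h_s^G(\theta)=c^{-1}(h_s(\theta)h_s^\ell(\theta))^{1/2}$, where $c=\int_\Theta(h_s(\theta)h_s^\ell(\theta))^{1/2}d\theta$, and $H_s^G$ is the corresponding distribution function. *)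

theory Defs
  imports "HOL-Probability.Probability"
begin

text \<open>
  The model is a family \<open>p :: real \<Rightarrow> real pmf\<close>, where \<open>p \<theta>\<close> is the law of the observation \<open>S\<close>
  under \<open>\<theta>\<close>. The parameter space is the open interval \<open>einterval a b\<close> with \<open>a < b\<close> extended reals,
  so \<open>a = inf \<Theta>\<close> and \<open>b = sup \<Theta>\<close> may be infinite. Nothing below depends on \<open>p \<theta>\<close> for \<open>\<theta>\<close>
  outside this interval.
\<close>

definition cdf_obs :: "(real \<Rightarrow> real pmf) \<Rightarrow> real \<Rightarrow> real \<Rightarrow> real" where
  "cdf_obs p \<theta> s = measure_pmf.prob (p \<theta>) {..s}"

definition fid_right :: "(real \<Rightarrow> real pmf) \<Rightarrow> real \<Rightarrow> real \<Rightarrow> real" where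
  "fid_right p s \<theta> = 1 - cdf_obs p \<theta> s"

definition fid_left :: "(real \<Rightarrow> real pmf) \<Rightarrow> real \<Rightarrow> real \<Rightarrow> real" where
  "fid_left p s \<theta> = 1 - measure_pmf.prob (p \<theta>) {..<s}"

lemma fid_right_eq_prob: "fid_right p s \<theta> = measure_pmf.prob (p \<theta>) {s<..}"
proof -
  have "{s<..} = space (measure_pmf (p \<theta>)) - {..s}" by auto
  then show ?thesis
    by (simp add: fid_right_def cdf_obs_def measure_pmf.prob_compl del: space_measure_pmf)
qed

lemma fid_left_eq_prob: "fid_left p s \<theta> = measure_pmf.prob (p \<theta>) {s..}"
proof -
  have "{s..} = space (measure_pmf (p \<theta>)) - {..<s}" by auto
  then show ?thesis
    by (simp add: fid_left_def measure_pmf.prob_compl del: space_measure_pmf)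
qed

text \<open>
  A differentiable distribution function on \<open>einterval a b\<close>. Limits at the (possibly infinite) end
  points are taken as in the interval integral library, along \<open>real_of_ereal\<close>. Monotonicity is meant
  in the weak sense.
\<close>

definition distribution_fun_on :: "ereal \<Rightarrow> ereal \<Rightarrow> (real \<Rightarrow> real) \<Rightarrow> bool" where
  "distribution_fun_on a b G \<longleftrightarrow>
     mono_on (einterval a b) G \<and>
     G differentiable_on einterval a b \<and>
     ((G \<circ> real_of_ereal) \<longlongrightarrow> 0) (at_right a) \<and>
     ((G \<circ> real_of_ereal) \<longlongrightarrow> 1) (at_left b)"

definition obs_values :: "ereal \<Rightarrow> ereal \<Rightarrow> (real \<Rightarrow> real pmf) \<Rightarrow> real set" where
  "obs_values a b p = (\<Union>\<theta>\<in>einterval a b. set_pmf (p \<theta>))"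

text \<open>
  Only values that \<open>S\<close> can take are considered. Without this restriction a point \<open>s\<close> lying between
  two values of \<open>S\<close> could qualify, with \<open>fid_right\<close> and \<open>fid_left\<close> equal.
\<close>

definition fid_points :: "ereal \<Rightarrow> ereal \<Rightarrow> (real \<Rightarrow> real pmf) \<Rightarrow> real set" where
  "fid_points a b p =
     {s \<in> obs_values a b p.
        distribution_fun_on a b (fid_right p s) \<and> distribution_fun_on a b (fid_left p s)}"

definition fid_right_density :: "(real \<Rightarrow> real pmf) \<Rightarrow> real \<Rightarrow> real \<Rightarrow> real" where
  "fid_right_density p s \<theta> = deriv (fid_right p s) \<theta>"

definition fid_left_density :: "(real \<Rightarrow> real pmf) \<Rightarrow> real \<Rightarrow> real \<Rightarrow> real" where
  "fid_left_density p s \<theta> = deriv (fid_left p s) \<theta>"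

definition fid_gamma :: "(real \<Rightarrow> real pmf) \<Rightarrow> real \<Rightarrow> real \<Rightarrow> real" where
  "fid_gamma p s \<theta> = deriv (\<lambda>t. pmf (p t) s) \<theta> / fid_right_density p s \<theta>"

definition fid_arith :: "(real \<Rightarrow> real pmf) \<Rightarrow> real \<Rightarrow> real \<Rightarrow> real" where
  "fid_arith p s \<theta> = (fid_right p s \<theta> + fid_left p s \<theta>) / 2"

definition fid_geom_const :: "ereal \<Rightarrow> ereal \<Rightarrow> (real \<Rightarrow> real pmf) \<Rightarrow> real \<Rightarrow> real" where
  "fid_geom_const a b p s =
     (LBINT t=a..b. sqrt (fid_right_density p s t * fid_left_density p s t))"

definition fid_geom_density ::
    "ereal \<Rightarrow> ereal \<Rightarrow> (real \<Rightarrow> real pmf) \<Rightarrow> real \<Rightarrow> real \<Rightarrow> real" where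
  "fid_geom_density a b p s \<theta> =
     sqrt (fid_right_density p s \<theta> * fid_left_density p s \<theta>) / fid_geom_const a b p s"

definition fid_geom :: "ereal \<Rightarrow> ereal \<Rightarrow> (real \<Rightarrow> real pmf) \<Rightarrow> real \<Rightarrow> real \<Rightarrow> real" where
  "fid_geom a b p s \<theta> = (LBINT t=a..ereal \<theta>. fid_geom_density a b p s t)"

end

theory Submission
  imports Defs
begin

text \<open>
  Fix \<open>s\<close> and write \<open>h\<close> and \<open>g\<close> for the right and left fiducial densities. Since
  \<open>fid_left - fid_right\<close> is the probability of \<open>s\<close>, the quotient \<open>g / h\<close> equals \<open>1 + \<gamma>\<close>, so it
  decreases from \<open>\<infinity>\<close> to \<open>0\<close>. Put \<open>u = sqrt (g / h)\<close>. The density of the geometric mean minus that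
  of the arithmetic mean is

  \<open>d = sqrt (h g) / c - (h + g) / 2 = (h / 2) ((2 / c) u - (1 + u\<^sup>2))\<close>.

  The bracket is a concave quadratic in \<open>u\<close>, so it is positive exactly when \<open>u\<close> lies in some
  interval, and it is negative for \<open>u\<close> close to \<open>0\<close> and for \<open>u\<close> large. As \<open>u\<close> is monotone in
  \<open>\<theta>\<close>, the set where \<open>d > 0\<close> is an interval and \<open>d < 0\<close> near both ends of \<open>\<Theta>\<close>.

  Let \<open>D \<theta>\<close> be the integral of \<open>d\<close> from the left end to \<open>\<theta>\<close>. All the densities have total mass \<open>1\<close>,
  hence \<open>D\<close> starts and ends at \<open>0\<close>. If \<open>0 \<le> D x\<close> and \<open>x < y\<close> then \<open>0 < D y\<close>: otherwise \<open>d\<close> would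
  take positive values before \<open>x\<close>, to outweigh the initial decrease, and after \<open>y\<close>, to outweigh
  the final one. Then \<open>d\<close> would be positive all along from \<open>x\<close> to \<open>y\<close>, and \<open>D\<close> would increase
  strictly there. Therefore the supremum of \<open>{D < 0}\<close> is the crossing point (lemma
  \<open>single_crossing_integral\<close>).

  The fiducial distribution functions are recovered from \<open>h\<close> and \<open>g\<close> by the fundamental theorem of
  calculus. The distribution function of \<open>S\<close> may be a sum of infinitely many probabilities, so \<open>h\<close> and
  \<open>g\<close> may be discontinuous; monotonicity in \<open>\<theta>\<close> replaces continuity (lemma \<open>mono_FTC\<close>).
\<close>

section \<open>Integrating the derivative of a monotone function\<close>

text \<open>On \<open>S\<close> the derivative is a pointwise limit of difference quotients of the measurable
  function \<open>G\<close> that extends \<open>F\<close> by zero. Openness of \<open>S\<close> makes \<open>F\<close> and \<open>G\<close> agree near each of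
  its points.\<close>

lemma set_borel_measurable_deriv:
  fixes F :: "real \<Rightarrow> real"
  assumes "open S" and diff: "F differentiable_on S"
  shows "set_borel_measurable borel S (deriv F)"
proof -
  define G where "G x = indicator S x *\<^sub>R F x" for x
  have S [measurable]: "S \<in> sets borel"
    using \<open>open S\<close> by simp
  have [measurable]: "G \<in> borel_measurable borel"
    unfolding G_def using S diff
    by (intro borel_measurable_continuous_on_indicator differentiable_imp_continuous_on)
  have "(\<lambda>x. indicator S x *\<^sub>R deriv F x) \<in> borel_measurable borel"
  proof (rule borel_measurable_LIMSEQ_real)
    fix x
    show "(\<lambda>n. indicator S x * ((G (x + inverse (real (Suc n))) - G x) / inverse (real (Suc n))))
            \<longlonglongrightarrow> indicator S x *\<^sub>R deriv F x"
    proof (cases "x \<in> S")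
      case True
      then have "(F has_real_derivative deriv F x) (at x)"
        using diff \<open>open S\<close>
        by (metis DERIV_deriv_iff_real_differentiable at_within_open differentiable_on_def)
      moreover have "eventually (\<lambda>y. F y = G y) (nhds x)"
        using True \<open>open S\<close> unfolding eventually_nhds G_def by auto
      ultimately have "(G has_real_derivative deriv F x) (at x)"
        using DERIV_cong_ev by blast
      then have "((\<lambda>h. (G (x + h) - G x) / h) \<longlongrightarrow> deriv F x) (at 0)"
        by (simp add: DERIV_def)
      moreover have "filterlim (\<lambda>n. inverse (real (Suc n))) (at 0) sequentially"
        using LIMSEQ_inverse_real_of_nat by (intro filterlim_atI) auto
      ultimately have "(\<lambda>n. (G (x + inverse (real (Suc n))) - G x) / inverse (real (Suc n)))
                         \<longlonglongrightarrow> deriv F x"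
        by (rule filterlim_compose)
      then show ?thesis using True by simp
    qed simp
  qed measurable
  then show ?thesis
    unfolding set_borel_measurable_def .
qed

lemma einterval_convex:
  assumes "x \<in> einterval a b" "z \<in> einterval a b" "x \<le> y" "y \<le> z"
  shows "y \<in> einterval a b"
  using assms unfolding einterval_iff by (meson ereal_less_eq(3) le_less_trans less_le_trans)

lemma einterval_mono:
  assumes "a \<le> x" "y \<le> b"
  shows "einterval x y \<subseteq> einterval a b"
  using assms by (auto simp: einterval_iff intro: le_less_trans less_le_trans)

text \<open>The derivative may be discontinuous, but it is nonnegative and measurable, which suffices on
  compact intervals. Exhausting the open interval by compact ones and monotone convergence give
  both the integrability and the value.\<close>

lemma mono_FTC:
  fixes F :: "real \<Rightarrow> real" and a b :: ereal
  assumes "a < b"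
    and mono: "mono_on (einterval a b) F" and diff: "F differentiable_on einterval a b"
    and A: "((F \<circ> real_of_ereal) \<longlongrightarrow> A) (at_right a)"
    and B: "((F \<circ> real_of_ereal) \<longlongrightarrow> B) (at_left b)"
  shows mono_FTC_integrable: "set_integrable lborel (einterval a b) (deriv F)"
    and mono_FTC_integral: "(LBINT x=a..b. deriv F x) = B - A"
proof -
  obtain u l where approx:
    "einterval a b = (\<Union>i. {l i .. u i})"
    "incseq u" "decseq l" "\<And>i. l i < u i" "\<And>i. a < l i" "\<And>i. u i < b"
    "l \<longlonglongrightarrow> a" "u \<longlonglongrightarrow> b"
    by (blast intro: einterval_Icc_approximation[OF \<open>a < b\<close>])
  let ?f = "\<lambda>x. indicator (einterval a b) x *\<^sub>R deriv F x"
  have D: "(F has_real_derivative deriv F x) (at x)" if "x \<in> einterval a b" for x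
    using diff that open_einterval
    by (metis DERIV_deriv_iff_real_differentiable at_within_open differentiable_on_def)
  have nonneg: "0 \<le> deriv F x" if "x \<in> einterval a b" for x
    using mono_on_imp_deriv_nonneg[OF mono D[OF that]] that by (simp add: interior_open)
  have meas: "set_borel_measurable borel (einterval a b) (deriv F)"
    by (rule set_borel_measurable_deriv) (use diff in auto)
  have sub: "{l i..u i} \<subseteq> einterval a b" for i
    using approx(1) by blast
  have fin: "has_bochner_integral lborel (\<lambda>x. ?f x * indicator {l i..u i} x) (F (u i) - F (l i))" for i
  proof (rule has_bochner_integral_FTC_Icc_nonneg)
    show "?f \<in> borel_measurable borel"
      using meas by (simp add: set_borel_measurable_def)
    show "(F has_real_derivative ?f x) (at x)" if "x \<in> {l i..u i}" for x
      using D sub that by (metis indicator_simps(1) scaleR_one subsetD)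
    show "0 \<le> ?f x" for x
      using nonneg by (auto simp: indicator_def)
    show "l i \<le> u i"
      using approx(4) less_imp_le by blast
  qed
  have eq: "?f x * indicator {l i..u i} x = indicator {l i..u i} x *\<^sub>R deriv F x" for i x
    using sub[of i] by (auto simp: indicator_def)
  have 1: "set_integrable lborel {l i..u i} (deriv F)" for i
    using fin[of i] unfolding eq set_integrable_def has_bochner_integral_iff by blast
  have I: "(LBINT x=l i..u i. deriv F x) = F (u i) - F (l i)" for i
    using fin[of i] approx(4)[of i] unfolding eq has_bochner_integral_iff
    by (simp add: interval_integral_Icc set_lebesgue_integral_def)
  have 0: "AE x in lborel. a < ereal x \<longrightarrow> ereal x < b \<longrightarrow> 0 \<le> deriv F x"
    using nonneg by (simp add: einterval_iff)
  have 2: "set_borel_measurable lborel (einterval a b) (deriv F)"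
    using meas by (simp add: set_borel_measurable_def)
  have "(\<lambda>x. F (l x)) \<longlonglongrightarrow> A"
    using A approx unfolding tendsto_at_iff_sequentially comp_def
    by (force elim!: allE[of _ "\<lambda>i. ereal (l i)"])
  moreover have "(\<lambda>x. F (u x)) \<longlonglongrightarrow> B"
    using B approx unfolding tendsto_at_iff_sequentially comp_def
    by (force elim!: allE[of _ "\<lambda>i. ereal (u i)"])
  ultimately have 3: "(\<lambda>i. LBINT x=l i..u i. deriv F x) \<longlonglongrightarrow> B - A"
    by (simp add: I tendsto_diff)
  show "(LBINT x=a..b. deriv F x) = B - A"
    by (rule interval_integral_Icc_approx_nonneg [OF \<open>a < b\<close> approx 1 0 2 3])
  show "set_integrable lborel (einterval a b) (deriv F)"
    by (rule interval_integral_Icc_approx_nonneg [OF \<open>a < b\<close> approx 1 0 2 3])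
qed

lemma distribution_fun_on_integrable_deriv:
  assumes "a < b" "distribution_fun_on a b G"
  shows "set_integrable lborel (einterval a b) (deriv G)"
  using assms mono_FTC_integrable unfolding distribution_fun_on_def by blast

lemma distribution_fun_on_integral_deriv:
  assumes "a < b" "distribution_fun_on a b G"
  shows "(LBINT t=a..b. deriv G t) = 1"
  using assms mono_FTC_integral[of a b G 0 1] unfolding distribution_fun_on_def by simp

lemma distribution_fun_on_eq_integral_deriv:
  assumes G: "distribution_fun_on a b G" and x: "x \<in> einterval a b"
  shows "(LBINT t=a..ereal x. deriv G t) = G x"
proof -
  have sub: "einterval a (ereal x) \<subseteq> einterval a b"
    using x by (intro einterval_mono) (auto simp: einterval_iff)
  have "isCont G x"
    using G x open_einterval differentiable_imp_continuous_on continuous_on_eq_continuous_at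
    unfolding distribution_fun_on_def by blast
  then have "((G \<circ> real_of_ereal) \<longlongrightarrow> G x) (at_left (ereal x))"
    unfolding ereal_tendsto_simps1 isCont_def by (rule filterlim_at_split[THEN iffD1, THEN conjunct1])
  then have "(LBINT t=a..ereal x. deriv G t) = G x - 0"
    using G x sub unfolding distribution_fun_on_def
    by (intro mono_FTC_integral)
       (auto simp: einterval_iff intro: mono_on_subset differentiable_on_subset)
  then show ?thesis by simp
qed

section \<open>Sign changes of an indefinite integral\<close>

text \<open>Positivity is required on a subinterval only: this is what yields the strict inequalities
  between distribution functions.\<close>

lemma set_integral_pos_einterval:
  fixes f :: "real \<Rightarrow> real" and a b x y :: ereal
  assumes int: "set_integrable lborel (einterval a b) f"
    and nonneg: "\<And>t. t \<in> einterval a b \<Longrightarrow> 0 \<le> f t"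
    and sub: "a \<le> x" "x < y" "y \<le> b"
    and pos: "\<And>t. t \<in> einterval x y \<Longrightarrow> 0 < f t"
  shows "0 < (LBINT t=a..b. f t)"
proof -
  let ?f = "\<lambda>t. indicator (einterval a b) t *\<^sub>R f t"
  have I: "(LBINT t=a..b. f t) = integral\<^sup>L lborel ?f"
    using sub by (simp add: interval_lebesgue_integral_def set_lebesgue_integral_def)
  have nn: "0 \<le> ?f t" for t
    using nonneg by (auto simp: indicator_def)
  have "integral\<^sup>L lborel ?f \<noteq> 0"
  proof
    assume "integral\<^sup>L lborel ?f = 0"
    then have ae: "AE t in lborel. ?f t = 0"
      using int nn by (subst (asm) integral_nonneg_eq_0_iff_AE) (auto simp: set_integrable_def)
    have ne: "?f t \<noteq> 0" if "t \<in> einterval x y" for t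
    proof -
      have "t \<in> einterval a b"
        using that sub by (auto simp: einterval_iff)
      then show ?thesis using pos[OF that] by simp
    qed
    have "AE t in lborel. t \<notin> einterval x y"
      by (rule eventually_mono[OF ae]) (use ne in blast)
    then have null: "emeasure lborel (einterval x y) = 0"
      using AE_iff_null_sets[of "einterval x y" lborel] by (simp add: null_setsD1)
    obtain v where v: "x < ereal v" "ereal v < y"
      using ereal_dense2[OF \<open>x < y\<close>] by blast
    obtain w where w: "ereal v < ereal w" "ereal w < y"
      using ereal_dense2[OF v(2)] by blast
    have vw: "v \<in> einterval x y" "w \<in> einterval x y"
      using v w(2) less_trans[OF v(1) w(1)] by (simp_all add: einterval_iff)
    have "{v..w} \<subseteq> einterval x y"
    proof
      fix t assume "t \<in> {v..w}"
      then show "t \<in> einterval x y"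
        using einterval_convex[OF vw] by simp
    qed
    then have "emeasure lborel {v..w} \<le> emeasure lborel (einterval x y)"
      by (intro emeasure_mono) auto
    then show False
      using null w by simp
  qed
  moreover have "0 \<le> integral\<^sup>L lborel ?f"
    using nn by (intro Bochner_Integration.integral_nonneg) auto
  ultimately show ?thesis
    unfolding I by linarith
qed

lemma eventually_at_right_einterval:
  fixes a b :: ereal
  assumes "a < b" and ev: "eventually (\<lambda>x. P (real_of_ereal x)) (at_right a)"
  obtains t where "t \<in> einterval a b" "\<And>x. x \<in> einterval a (ereal t) \<Longrightarrow> P x"
proof -
  obtain c where c: "c > a" "\<And>y. y > a \<Longrightarrow> y < c \<Longrightarrow> P (real_of_ereal y)"
    using ev unfolding eventually_at_right[OF \<open>a < b\<close>] by blast
  obtain t where t: "a < ereal t" "ereal t < min b c"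
    using ereal_dense2[of a "min b c"] \<open>a < b\<close> c(1) by auto
  show thesis
  proof
    show "t \<in> einterval a b" using t by (simp add: einterval_iff)
    show "P x" if "x \<in> einterval a (ereal t)" for x
      using c(2)[of "ereal x"] t that by (auto simp: einterval_iff)
        (metis ereal_less(1) less_trans less_ereal.simps(1))
  qed
qed

lemma eventually_at_left_einterval:
  fixes a b :: ereal
  assumes "a < b" and ev: "eventually (\<lambda>x. P (real_of_ereal x)) (at_left b)"
  obtains t where "t \<in> einterval a b" "\<And>x. x \<in> einterval (ereal t) b \<Longrightarrow> P x"
proof -
  obtain c where c: "c < b" "\<And>y. y > c \<Longrightarrow> y < b \<Longrightarrow> P (real_of_ereal y)"
    using ev unfolding eventually_at_left[OF \<open>a < b\<close>] by blast
  obtain t where t: "max a c < ereal t" "ereal t < b"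
    using ereal_dense2[of "max a c" b] \<open>a < b\<close> c(1) by auto
  show thesis
  proof
    show "t \<in> einterval a b" using t by (simp add: einterval_iff)
    show "P x" if "x \<in> einterval (ereal t) b" for x
      using c(2)[of "ereal x"] t that by (auto simp: einterval_iff)
        (metis less_trans less_ereal.simps(1))
  qed
qed

text \<open>The sign pattern of \<open>d\<close> is \<open>- + -\<close>, apart from zeros. Up to a point that
  no positive value precedes, \<open>D\<close> integrates values of one sign and is negative; from a point that no
  positive value follows, \<open>D\<close> is minus such an integral, because the total is zero, and is positive.
  Any other point lies where \<open>D\<close> increases strictly, so \<open>D\<close> changes sign once.\<close>

lemma single_crossing_integral:
  fixes d :: "real \<Rightarrow> real" and a b :: ereal
  assumes int: "set_integrable lborel (einterval a b) d"
    and zero: "(LBINT t=a..b. d t) = 0"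
    and convex: "\<And>x y z. \<lbrakk>x \<in> einterval a b; z \<in> einterval a b; x \<le> y; y \<le> z; 0 < d x; 0 < d z\<rbrakk>
                   \<Longrightarrow> 0 < d y"
    and left: "t0 \<in> einterval a b" "\<And>t. t \<in> einterval a (ereal t0) \<Longrightarrow> d t < 0"
    and right: "t1 \<in> einterval a b" "\<And>t. t \<in> einterval (ereal t1) b \<Longrightarrow> d t < 0"
  shows "\<exists>c\<in>einterval a b.
           (\<forall>x\<in>einterval a b. x < c \<longrightarrow> (LBINT t=a..ereal x. d t) < 0) \<and>
           (\<forall>x\<in>einterval a b. c < x \<longrightarrow> 0 < (LBINT t=a..ereal x. d t))"
proof -
  define D where "D x = (LBINT t=a..ereal x. d t)" for x
  have int': "set_integrable lborel (einterval x y) d" if "a \<le> x" "y \<le> b" for x y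
    using int by (rule set_integrable_subset)
      (use that in \<open>auto simp: einterval_iff intro: le_less_trans less_le_trans\<close>)
  have add: "(LBINT t=x..y. d t) + (LBINT t=y..z. d t) = (LBINT t=x..z. d t)"
    if "a \<le> x" "x \<le> y" "y \<le> z" "z \<le> b" for x y z
    using that by (intro interval_integral_sum)
      (auto simp: interval_lebesgue_integrable_def min_def max_def intro!: int')
  have neg: "(LBINT t=x..y. d t) < 0"
    if "a \<le> x" "y \<le> b" "x \<le> v" "v < w" "w \<le> y" "\<And>t. t \<in> einterval x y \<Longrightarrow> d t \<le> 0"
      "\<And>t. t \<in> einterval v w \<Longrightarrow> d t < 0" for x y v w
  proof -
    have "0 < (LBINT t=x..y. - d t)"
      by (rule set_integral_pos_einterval[where x=v and y=w])
         (use that int'[of x y] in \<open>auto simp: set_integrable_def\<close>)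
    then show ?thesis by (simp add: interval_lebesgue_integral_uminus)
  qed
  have rest: "D x = - (LBINT t=ereal x..b. d t)" if "x \<in> einterval a b" for x
    using add[of a "ereal x" b] that zero by (simp add: D_def einterval_iff less_imp_le)
  have before: "\<exists>t. t \<in> einterval a (ereal x) \<and> 0 < d t" if "x \<in> einterval a b" "0 \<le> D x" for x
  proof (rule ccontr)
    assume "\<not> ?thesis"
    then have le: "d t \<le> 0" if "t \<in> einterval a (ereal x)" for t
      using that by (meson not_less)
    have "D x < 0"
      unfolding D_def
    proof (rule neg[where v=a and w="ereal (min x t0)"])
      show "d t < 0" if "t \<in> einterval a (ereal (min x t0))" for t
        using that left(2)[of t] by (simp add: einterval_iff)
    qed (use that left(1) le in \<open>auto simp: einterval_iff min_def\<close>)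
    then show False using that by simp
  qed
  have after: "\<exists>t. t \<in> einterval (ereal x) b \<and> 0 < d t" if "x \<in> einterval a b" "D x \<le> 0" for x
  proof (rule ccontr)
    assume "\<not> ?thesis"
    then have le: "d t \<le> 0" if "t \<in> einterval (ereal x) b" for t
      using that by (meson not_less)
    have "(LBINT t=ereal x..b. d t) < 0"
    proof (rule neg[where v="ereal (max x t1)" and w=b])
      show "d t < 0" if "t \<in> einterval (ereal (max x t1)) b" for t
        using that right(2)[of t] by (simp add: einterval_iff)
    qed (use that right(1) le in \<open>auto simp: einterval_iff max_def\<close>)
    then show False using that rest by simp
  qed
  \<comment> \<open>Were \<open>D y \<le> 0\<close>, there would be points \<open>v < x\<close> and \<open>w > y\<close> with \<open>d\<close> positive; convexity then
    makes \<open>d\<close> positive on the whole of \<open>(x, y)\<close>, contradicting \<open>D y \<le> 0 \<le> D x\<close>.\<close>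
  have cross: "0 < D y" if xy: "x \<in> einterval a b" "y \<in> einterval a b" "x < y" "0 \<le> D x" for x y
  proof (rule ccontr)
    assume "\<not> 0 < D y"
    obtain v where v: "v \<in> einterval a (ereal x)" "0 < d v"
      using before xy by blast
    obtain w where w: "w \<in> einterval (ereal y) b" "0 < d w"
      using after[of y] xy \<open>\<not> 0 < D y\<close> by auto
    have "0 < d t" if "t \<in> einterval (ereal x) (ereal y)" for t
    proof (rule convex[of v w])
      show "v \<in> einterval a b" "w \<in> einterval a b"
        using v w xy(1,2)
          einterval_mono[of a a "ereal x" b] einterval_mono[of a "ereal y" b b]
        by (auto simp: einterval_iff less_imp_le)
      show "v \<le> t" "t \<le> w"
        using v w that by (auto simp: einterval_iff)
    qed (use v w in auto)
    then have "0 < (LBINT t=ereal x..ereal y. d t)"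
      using xy
      by (intro set_integral_pos_einterval[where x="ereal x" and y="ereal y"] int')
         (auto simp: einterval_iff intro: less_imp_le)
    moreover have "D x + (LBINT t=ereal x..ereal y. d t) = D y"
      unfolding D_def using xy by (intro add) (auto simp: einterval_iff)
    ultimately show False
      using xy(4) \<open>\<not> 0 < D y\<close> by linarith
  qed
  \<comment> \<open>By \<open>cross\<close>, \<open>N\<close> is an initial segment of the interval, and \<open>D\<close> is positive strictly above its
    supremum. The points \<open>t0\<close> and \<open>t1\<close> keep the supremum away from the ends.\<close>
  define N where "N = {x \<in> einterval a b. D x < 0}"
  have "t0 \<in> N"
  proof -
    have "D t0 < 0"
      unfolding D_def using left
      by (intro neg[where v=a and w="ereal t0"]) (auto simp: einterval_iff intro: less_imp_le)
    then show ?thesis using left by (simp add: N_def)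
  qed
  have "0 < D t1"
  proof -
    have "(LBINT t=ereal t1..b. d t) < 0"
      using right
      by (intro neg[where v="ereal t1" and w=b]) (auto simp: einterval_iff intro: less_imp_le)
    then show ?thesis using right rest by simp
  qed
  have upper: "x \<le> t1" if "x \<in> N" for x
    using cross[of t1 x] that \<open>0 < D t1\<close> right(1) by (force simp: N_def)
  then have bdd: "bdd_above N" by (rule bdd_aboveI)
  have "t0 \<le> Sup N" "Sup N \<le> t1"
    using \<open>t0 \<in> N\<close> bdd upper by (auto intro: cSup_upper cSup_least)
  then have "Sup N \<in> einterval a b"
    using left(1) right(1) einterval_convex by blast
  moreover have "D x < 0" if "x \<in> einterval a b" "x < Sup N" for x
  proof -
    obtain y where "y \<in> N" "x < y"
      using \<open>x < Sup N\<close> \<open>t0 \<in> N\<close> less_cSupD by blast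
    then show ?thesis
      using cross[of x y] that by (force simp: N_def)
  qed
  moreover have "0 < D x" if "x \<in> einterval a b" "Sup N < x" for x
  proof -
    obtain y where y: "Sup N < y" "y < x"
      using dense[OF \<open>Sup N < x\<close>] by blast
    have "y \<in> einterval a b"
      using y that \<open>Sup N \<in> einterval a b\<close> einterval_convex[of "Sup N" a b x y] by simp
    moreover have "y \<notin> N"
      using y(1) bdd cSup_upper by fastforce
    ultimately show ?thesis
      using cross[of y x] that y by (force simp: N_def)
  qed
  ultimately show ?thesis
    unfolding D_def by blast
qed

section \<open>Geometric against arithmetic mean of two densities\<close>

lemma scaled_quadratic_pos_between:
  fixes k u v w :: real
  assumes "u \<le> v" "v \<le> w" "0 < k * u - (1 + u\<^sup>2)" "0 < k * w - (1 + w\<^sup>2)"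
  shows "0 < k * v - (1 + v\<^sup>2)"
proof (cases "u = w")
  case False
  \<comment> \<open>The chord through the values at \<open>u\<close> and \<open>w\<close>, plus the excess of a concave quadratic over it.\<close>
  have "(w - u) * (k * v - (1 + v\<^sup>2)) =
      (w - v) * (k * u - (1 + u\<^sup>2)) + (v - u) * (k * w - (1 + w\<^sup>2)) + (w - u) * (v - u) * (w - v)"
    by (simp add: algebra_simps power2_eq_square)
  moreover have "0 \<le> (w - u) * (v - u) * (w - v)"
    using assms by simp
  moreover have "0 < (w - v) * (k * u - (1 + u\<^sup>2)) + (v - u) * (k * w - (1 + w\<^sup>2))"
  proof (cases "v = w")
    case True
    then show ?thesis using assms False by simp
  next
    case False
    then show ?thesis using assms by (intro add_pos_nonneg mult_pos_pos mult_nonneg_nonneg) auto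
  qed
  ultimately have "0 < (w - u) * (k * v - (1 + v\<^sup>2))" by linarith
  then show ?thesis using assms False by (simp add: zero_less_mult_iff)
qed (use assms in auto)

text \<open>With \<open>u = sqrt (g / h)\<close>, the sign of the difference of the mean densities is that of the concave
  quadratic \<open>(2 / c) u - (1 + u\<^sup>2)\<close>. The monotone likelihood ratio \<open>g / h\<close> carries the convexity of
  its positivity set over to \<open>\<Theta>\<close>, and the two limits make it negative at both ends.\<close>

lemma geometric_arithmetic_single_crossing:
  fixes h g :: "real \<Rightarrow> real" and a b :: ereal
  defines "c \<equiv> (LBINT t=a..b. sqrt (h t * g t))"
  assumes "a < b"
    and h: "set_integrable lborel (einterval a b) h" "(LBINT t=a..b. h t) = 1"
    and g: "set_integrable lborel (einterval a b) g" "(LBINT t=a..b. g t) = 1"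
    and h_pos: "\<And>t. t \<in> einterval a b \<Longrightarrow> 0 < h t"
    and g_nonneg: "\<And>t. t \<in> einterval a b \<Longrightarrow> 0 \<le> g t"
    and anti: "antimono_on (einterval a b) (\<lambda>t. g t / h t)"
    and left: "filterlim ((\<lambda>t. g t / h t) \<circ> real_of_ereal) at_top (at_right a)"
    and right: "(((\<lambda>t. g t / h t) \<circ> real_of_ereal) \<longlongrightarrow> 0) (at_left b)"
  shows "\<exists>m\<in>einterval a b.
           (\<forall>x\<in>einterval a b. x < m \<longrightarrow>
              (LBINT t=a..ereal x. sqrt (h t * g t) / c) < (LBINT t=a..ereal x. (h t + g t) / 2)) \<and>
           (\<forall>x\<in>einterval a b. m < x \<longrightarrow>
              (LBINT t=a..ereal x. (h t + g t) / 2) < (LBINT t=a..ereal x. sqrt (h t * g t) / c))"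
proof -
  define u where "u t = sqrt (g t / h t)" for t
  define d where "d t = sqrt (h t * g t) / c - (h t + g t) / 2" for t
  have hg: "set_integrable lborel (einterval a b) (\<lambda>t. (h t + g t) / 2)"
    using h g by (intro set_integrable_divide set_integral_add)
  have [measurable]: "(\<lambda>t. indicator (einterval a b) t * h t) \<in> borel_measurable borel"
       "(\<lambda>t. indicator (einterval a b) t * g t) \<in> borel_measurable borel"
    using h(1) g(1) unfolding set_integrable_def by auto
  have "(\<lambda>t. sqrt ((indicator (einterval a b) t * h t) * (indicator (einterval a b) t * g t)))
          \<in> borel_measurable lborel"
    by measurable
  moreover have "sqrt ((indicator (einterval a b) t * h t) * (indicator (einterval a b) t * g t)) =
      indicator (einterval a b) t *\<^sub>R sqrt (h t * g t)" for t
    by (auto simp: indicator_def)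
  ultimately have "set_borel_measurable lborel (einterval a b) (\<lambda>t. sqrt (h t * g t))"
    by (simp add: set_borel_measurable_def)
  moreover have "norm (sqrt (h t * g t)) \<le> norm ((h t + g t) / 2)" if "t \<in> einterval a b" for t
    using arith_geo_mean_sqrt[of "h t" "g t"] h_pos[OF that] g_nonneg[OF that] by simp
  ultimately have geo: "set_integrable lborel (einterval a b) (\<lambda>t. sqrt (h t * g t))"
    by (intro set_integrable_bound[OF hg]) auto
  \<comment> \<open>Division by zero yields zero, so \<open>c \<noteq> 0\<close> has to be secured before \<open>c\<close> can normalise.\<close>
  have "0 < c"
  proof -
    have "eventually (\<lambda>x. 0 < g (real_of_ereal x) / h (real_of_ereal x)) (at_right a)"
      using left by (simp add: filterlim_at_top_dense comp_def)
    then obtain t where t: "t \<in> einterval a b"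
        "\<And>x. x \<in> einterval a (ereal t) \<Longrightarrow> 0 < g x / h x"
      using eventually_at_right_einterval[OF \<open>a < b\<close>, of "\<lambda>x. 0 < g x / h x"] by blast
    show ?thesis
      unfolding c_def
    proof (rule set_integral_pos_einterval[where x=a and y="ereal t"])
      show "0 < sqrt (h x * g x)" if "x \<in> einterval a (ereal t)" for x
      proof -
        have "x \<in> einterval a b"
          using that t(1) einterval_mono[of a a "ereal t" b]
          by (auto simp: einterval_iff less_imp_le)
        then show ?thesis
          using h_pos[of x] t(2)[OF that] by (simp add: zero_less_divide_iff)
      qed
    next
      show "0 \<le> sqrt (h x * g x)" if "x \<in> einterval a b" for x
        using h_pos[OF that] g_nonneg[OF that] by simp
    qed (use t geo in \<open>auto simp: einterval_iff less_imp_le\<close>)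
  qed
  have d_eq: "d t = h t / 2 * (2 / c * u t - (1 + (u t)\<^sup>2))" if "t \<in> einterval a b" for t
  proof -
    have "sqrt (h t * g t) = h t * u t"
    proof (rule real_sqrt_unique)
      show "(h t * u t)\<^sup>2 = h t * g t"
        using h_pos[OF that] g_nonneg[OF that]
        by (simp add: u_def power_mult_distrib) (simp add: power2_eq_square)
      show "0 \<le> h t * u t"
        using h_pos[OF that] g_nonneg[OF that] by (simp add: u_def)
    qed
    moreover have "g t = h t * (u t)\<^sup>2"
      using h_pos[OF that] g_nonneg[OF that] by (simp add: u_def)
    ultimately show ?thesis
      by (simp add: d_def field_simps)
  qed
  have d_pos_iff: "0 < d t \<longleftrightarrow> 0 < 2 / c * u t - (1 + (u t)\<^sup>2)" if "t \<in> einterval a b" for t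
    using h_pos[OF that] by (simp add: d_eq[OF that] zero_less_mult_iff)
  have d_neg: "d t < 0" if "t \<in> einterval a b" "2 / c * u t < 1 + (u t)\<^sup>2" for t
    using h_pos[OF that(1)] that(2) by (simp add: d_eq[OF that(1)] mult_less_0_iff)
  have int: "set_integrable lborel (einterval a b) d"
    unfolding d_def using geo hg by (intro set_integral_diff(1) set_integrable_divide[of c])
  have diff: "(LBINT t=a..y. d t) =
      (LBINT t=a..y. sqrt (h t * g t) / c) - (LBINT t=a..y. (h t + g t) / 2)"
    if "a \<le> y" "y \<le> b" for y
  proof -
    have "einterval a y \<subseteq> einterval a b"
      using that by (intro einterval_mono) auto
    then have "set_integrable lborel (einterval a y) (\<lambda>t. sqrt (h t * g t) / c)"
      "set_integrable lborel (einterval a y) (\<lambda>t. (h t + g t) / 2)"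
      using geo hg by (auto intro: set_integrable_subset)
    then show ?thesis
      unfolding d_def using that by (simp add: interval_lebesgue_integral_def set_integral_diff)
  qed
  have zero: "(LBINT t=a..b. d t) = 0"
    using less_imp_le[OF \<open>a < b\<close>] \<open>0 < c\<close> h g diff[of b]
    by (simp add: interval_lebesgue_integral_def c_def set_integral_add)
  \<comment> \<open>For \<open>u > 2 / c\<close> the square outweighs \<open>(2 / c) u\<close>, and for \<open>u < c / 2\<close> the constant \<open>1\<close> does.\<close>
  have ev_left: "eventually (\<lambda>x. (2 / c)\<^sup>2 < g (real_of_ereal x) / h (real_of_ereal x)) (at_right a)"
    using left by (simp add: filterlim_at_top_dense comp_def)
  obtain t0 where t0: "t0 \<in> einterval a b"
      "\<And>x. x \<in> einterval a (ereal t0) \<Longrightarrow> (2 / c)\<^sup>2 < g x / h x"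
    using eventually_at_right_einterval[OF \<open>a < b\<close> ev_left] by blast
  have "0 < (c / 2)\<^sup>2"
    using \<open>0 < c\<close> by simp
  then have ev_right: "eventually (\<lambda>x. g (real_of_ereal x) / h (real_of_ereal x) < (c / 2)\<^sup>2) (at_left b)"
    using order_tendstoD(2)[OF right, of "(c / 2)\<^sup>2"] by (simp add: comp_def)
  obtain t1 where t1: "t1 \<in> einterval a b"
      "\<And>x. x \<in> einterval (ereal t1) b \<Longrightarrow> g x / h x < (c / 2)\<^sup>2"
    using eventually_at_left_einterval[OF \<open>a < b\<close> ev_right] by blast
  have "\<exists>m\<in>einterval a b.
           (\<forall>x\<in>einterval a b. x < m \<longrightarrow> (LBINT t=a..ereal x. d t) < 0) \<and>
           (\<forall>x\<in>einterval a b. m < x \<longrightarrow> 0 < (LBINT t=a..ereal x. d t))"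
  proof (rule single_crossing_integral[OF int zero _ t0(1) _ t1(1)])
    fix x y z
    assume *: "x \<in> einterval a b" "z \<in> einterval a b" "x \<le> y" "y \<le> z" "0 < d x" "0 < d z"
    then have y: "y \<in> einterval a b"
      using einterval_convex by blast
    have "u z \<le> u y" "u y \<le> u x"
      using anti * y by (auto simp: u_def monotone_on_def)
    then show "0 < d y"
      using scaled_quadratic_pos_between[of "u z" "u y" "u x" "2 / c"] * y d_pos_iff by blast
  next
    fix t assume t: "t \<in> einterval a (ereal t0)"
    then have "2 / c < u t"
      using t0(2)[OF t] \<open>0 < c\<close> unfolding u_def by (intro real_less_rsqrt) auto
    then have "2 / c * u t < u t * u t"
      using \<open>0 < c\<close> by (intro mult_strict_right_mono) (auto intro: less_trans[rotated])
    then show "d t < 0"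
      using t t0(1) einterval_mono[of a a "ereal t0" b]
      by (intro d_neg) (auto simp: einterval_iff power2_eq_square less_imp_le)
  next
    fix t assume t: "t \<in> einterval (ereal t1) b"
    then have "u t < c / 2"
      using t1(2)[OF t] \<open>0 < c\<close> unfolding u_def by (intro real_less_lsqrt) auto
    then have "2 / c * u t < 1"
      using \<open>0 < c\<close> by (simp add: field_simps)
    then have "2 / c * u t < 1 + (u t)\<^sup>2"
      using zero_le_power2[of "u t"] by linarith
    then show "d t < 0"
      using t t1(1) einterval_mono[of a "ereal t1" b b]
      by (intro d_neg) (auto simp: einterval_iff less_imp_le)
  qed
  then show ?thesis
    using diff by (force simp: einterval_iff less_imp_le)
qed

theorem proposition4:
  fixes a b :: ereal and p :: "real \<Rightarrow> real pmf"
  assumes "a < b"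
    and "\<And>s. (\<lambda>\<theta>. pmf (p \<theta>) s) differentiable_on einterval a b"
    and "\<And>s. continuous_on (einterval a b) (deriv (\<lambda>\<theta>. pmf (p \<theta>) s))"
    and "\<And>s \<theta>. s \<in> fid_points a b p \<Longrightarrow> \<theta> \<in> einterval a b \<Longrightarrow> 0 < fid_right_density p s \<theta>"
    and "\<And>s. s \<in> fid_points a b p \<Longrightarrow> antimono_on (einterval a b) (fid_gamma p s)"
    and "\<And>s. s \<in> fid_points a b p \<Longrightarrow>
           filterlim (fid_gamma p s \<circ> real_of_ereal) at_top (at_right a)"
    and "\<And>s. s \<in> fid_points a b p \<Longrightarrow>
           ((fid_gamma p s \<circ> real_of_ereal) \<longlongrightarrow> -1) (at_left b)"
  shows "\<forall>s\<in>fid_points a b p. \<exists>\<theta>'\<in>einterval a b.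
           (\<forall>\<theta>\<in>einterval a b. \<theta> < \<theta>' \<longrightarrow> fid_geom a b p s \<theta> < fid_arith p s \<theta>) \<and>
           (\<forall>\<theta>\<in>einterval a b. \<theta> > \<theta>' \<longrightarrow> fid_geom a b p s \<theta> > fid_arith p s \<theta>)"
proof
  fix s assume s: "s \<in> fid_points a b p"
  define h where "h = deriv (fid_right p s)"
  define g where "g = deriv (fid_left p s)"
  have R: "distribution_fun_on a b (fid_right p s)" and L: "distribution_fun_on a b (fid_left p s)"
    using s by (auto simp: fid_points_def)
  have h_pos: "0 < h t" if "t \<in> einterval a b" for t
    using assms(4)[OF s that] by (simp add: fid_right_density_def h_def)
  have D: "(F has_real_derivative deriv F t) (at t)"
    if "distribution_fun_on a b F" "t \<in> einterval a b" for F t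
    using that open_einterval unfolding distribution_fun_on_def
    by (metis DERIV_deriv_iff_real_differentiable at_within_open differentiable_on_def)
  have g_nonneg: "0 \<le> g t" if "t \<in> einterval a b" for t
    using mono_on_imp_deriv_nonneg[of "einterval a b" "fid_left p s" "g t" t] D[OF L that] L that
    by (simp add: interior_open g_def distribution_fun_on_def)
  have "pmf (p t) s = fid_left p s t - fid_right p s t" for t
  proof -
    have "{..s} = {..<s} \<union> {s}" by auto
    then have "measure_pmf.prob (p t) {..s} = measure_pmf.prob (p t) {..<s} + pmf (p t) s"
      by (simp add: measure_pmf.finite_measure_Union measure_pmf_single del: Un_insert_right)
    then show ?thesis
      by (simp add: fid_left_def fid_right_def cdf_obs_def)
  qed
  then have "deriv (\<lambda>t. pmf (p t) s) t = g t - h t" if "t \<in> einterval a b" for t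
    using D[OF L that] D[OF R that] unfolding g_def h_def
    by (auto intro!: DERIV_imp_deriv DERIV_diff)
  then have ratio: "g t / h t = 1 + fid_gamma p s t" if "t \<in> einterval a b" for t
    using h_pos[OF that] that
    by (simp add: fid_gamma_def fid_right_density_def h_def[symmetric] field_simps)
  have ev_right: "eventually (\<lambda>x. 1 + (fid_gamma p s \<circ> real_of_ereal) x
      = ((\<lambda>t. g t / h t) \<circ> real_of_ereal) x) (at_right a)"
    unfolding eventually_at_right[OF \<open>a < b\<close>]
  proof (intro exI[of _ b] conjI allI impI \<open>a < b\<close>)
    fix y assume "a < y" "y < b"
    then show "1 + (fid_gamma p s \<circ> real_of_ereal) y = ((\<lambda>t. g t / h t) \<circ> real_of_ereal) y"
      using ratio[of "real_of_ereal y"] by (cases y) (auto simp: einterval_iff)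
  qed
  have ev_left: "eventually (\<lambda>x. 1 + (fid_gamma p s \<circ> real_of_ereal) x
      = ((\<lambda>t. g t / h t) \<circ> real_of_ereal) x) (at_left b)"
    unfolding eventually_at_left[OF \<open>a < b\<close>]
  proof (intro exI[of _ a] conjI allI impI \<open>a < b\<close>)
    fix y assume "a < y" "y < b"
    then show "1 + (fid_gamma p s \<circ> real_of_ereal) y = ((\<lambda>t. g t / h t) \<circ> real_of_ereal) y"
      using ratio[of "real_of_ereal y"] by (cases y) (auto simp: einterval_iff)
  qed
  have anti: "antimono_on (einterval a b) (\<lambda>t. g t / h t)"
    using assms(5)[OF s] ratio by (simp add: monotone_on_def)
  have top: "filterlim ((\<lambda>t. g t / h t) \<circ> real_of_ereal) at_top (at_right a)"
    using filterlim_tendsto_add_at_top[OF tendsto_const assms(6)[OF s], of 1]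
      filterlim_cong[OF refl refl ev_right] by blast
  have bot: "(((\<lambda>t. g t / h t) \<circ> real_of_ereal) \<longlongrightarrow> 0) (at_left b)"
    using tendsto_add[OF tendsto_const assms(7)[OF s], of 1] tendsto_cong[OF ev_left] by (simp del: o_apply add: o_def)
  have int: "set_integrable lborel (einterval a b) h" "set_integrable lborel (einterval a b) g"
    using distribution_fun_on_integrable_deriv[OF \<open>a < b\<close>] R L by (auto simp: h_def g_def)
  have arith: "(LBINT t=a..ereal x. (h t + g t) / 2) = fid_arith p s x" if x: "x \<in> einterval a b" for x
  proof -
    have "einterval a (ereal x) \<subseteq> einterval a b" "a \<le> ereal x"
      using x einterval_mono[of a a "ereal x" b] by (simp_all add: einterval_iff less_imp_le)
    then have "(LBINT t=a..ereal x. (h t + g t) / 2) =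
        ((LBINT t=a..ereal x. h t) + (LBINT t=a..ereal x. g t)) / 2"
      using set_integrable_subset[OF int(1)] set_integrable_subset[OF int(2)]
      by (simp add: interval_lebesgue_integral_def set_integral_add)
    then show ?thesis
      using distribution_fun_on_eq_integral_deriv[OF R x] distribution_fun_on_eq_integral_deriv[OF L x]
      by (simp add: fid_arith_def h_def g_def)
  qed
  have geom: "(LBINT t=a..ereal x. sqrt (h t * g t) / (LBINT t=a..b. sqrt (h t * g t)))
      = fid_geom a b p s x" for x
    by (simp add: fid_geom_def fid_geom_density_def[abs_def] fid_geom_const_def
        fid_right_density_def[abs_def] fid_left_density_def[abs_def] h_def g_def)
  have "(LBINT t=a..b. h t) = 1" "(LBINT t=a..b. g t) = 1"
    using distribution_fun_on_integral_deriv[OF \<open>a < b\<close>] R L by (simp_all add: h_def g_def)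
  from geometric_arithmetic_single_crossing
      [OF \<open>a < b\<close> int(1) this(1) int(2) this(2) h_pos g_nonneg anti top bot, unfolded geom]
  show "\<exists>\<theta>'\<in>einterval a b.
           (\<forall>\<theta>\<in>einterval a b. \<theta> < \<theta>' \<longrightarrow> fid_geom a b p s \<theta> < fid_arith p s \<theta>) \<and>
           (\<forall>\<theta>\<in>einterval a b. \<theta> > \<theta>' \<longrightarrow> fid_geom a b p s \<theta> > fid_arith p s \<theta>)"
    using arith by force
qed

end
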